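(* Let $n>1$ be a natural number. Then $D(n)$ is equal to the smallest integer $k\ge 0$ such that $\delta(n)\le t_{\|n\|}(k)$. Moreover, if $n$ is any natural number, $D_{st}(n)$ is equal to the smallest integer $k\ge 0$ such that $\delta_{st}(n)\le t_{\|n\|_{st}}(k)$. In particular, for natural numbers $n,m$: if $\delta(n)=\delta(m)$ then $D(n)=D(m)$, and if $\delta_{st}(n)=\delta_{st}(m)$ then $D_{st}(n)=D_{st}(m)$.
   Context: Natural numbers are positive integers. The complexity $\|n\|$ of a natural number $n$ is the least number of $1$'s needed to write $n$ using any combination of addition and multiplication (with arbitrary parenthesization). The defect of $n$ is $\delta(n)=\|n\|-3\log_3 n$. For $k\ge 1$, $E(k)$ is the largest natural number $n$ with $\|n\|\le k$. $L(n)$ is the largest $k\ge 1$ with $E(k)\le n$, and the integer defect of $n$ is $D(n)=\|n\|-L(n)$. A natural number $m$ is stable if $\|3^k m\|=3k+\|m\|$ for every $k\ge 0$. It is known that for every $n$ there is $k\ge 0$ with $3^k n$ stable. For any $k\ge 0$ such that $3^kn$ is stable, set $\|n\|_{st}=\|3^kn\|-3k$ (stable complexity), $\delta_{st}(n)=\delta(3^kn)$ (stable defect), and $D_{st}(n)=D(3^kn)$ (stable integer defect); these do not depend on the choice of $k$. For $a$ a congruence class modulo $3$ (or an integer, read modulo $3$) and $k\ge 0$ an integer, $t_a(k)=k$ if $k\equiv a\pmod 3$, $t_a(k)=k+\delta(2)$ if $k\equiv a+1\pmod 3$, and $t_a(k)=k+2\delta(2)$ if $k\equiv a+2\pmod 3$.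 *)

theory Defs
  imports Complex_Main "HOL-Number_Theory.Cong"
begin

text \<open>Natural numbers in the mathematical sense are the positive elements of \<^typ>\<open>nat\<close>;
  the values of the notions below at 0 are irrelevant.\<close>

datatype expr = One | Add expr expr | Mult expr expr

primrec expr_val :: "expr \<Rightarrow> nat" where
  "expr_val One = 1"
| "expr_val (Add e f) = expr_val e + expr_val f"
| "expr_val (Mult e f) = expr_val e * expr_val f"

primrec num_ones :: "expr \<Rightarrow> nat" where
  "num_ones One = 1"
| "num_ones (Add e f) = num_ones e + num_ones f"
| "num_ones (Mult e f) = num_ones e + num_ones f"

definition complexity :: "nat \<Rightarrow> nat" where
  "complexity n = (LEAST k. \<exists>e. expr_val e = n \<and> num_ones e = k)"

definition defect :: "nat \<Rightarrow> real" where
  "defect n = real (complexity n) - 3 * log 3 (real n)"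

text \<open>Meaningful for \<open>k \<ge> 1\<close> only. The guard \<open>n \<ge> 1\<close> is needed because 0 is not the value of
  any expression, so that \<^term>\<open>complexity 0\<close> is unspecified.\<close>

definition E :: "nat \<Rightarrow> nat" where
  "E k = (GREATEST n. n \<ge> 1 \<and> complexity n \<le> k)"

definition L :: "nat \<Rightarrow> nat" where
  "L n = (GREATEST k. k \<ge> 1 \<and> E k \<le> n)"

definition int_defect :: "nat \<Rightarrow> int" where
  "int_defect n = int (complexity n) - int (L n)"

definition stable :: "nat \<Rightarrow> bool" where
  "stable m \<longleftrightarrow> (\<forall>k. complexity (3 ^ k * m) = 3 * k + complexity m)"

text \<open>An arbitrary exponent making \<open>3 ^ k * n\<close> stable. For \<open>n \<ge> 1\<close> such an exponent exists, and the
  three stable notions below do not depend on which one is chosen.\<close>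

definition stab_exp :: "nat \<Rightarrow> nat" where
  "stab_exp n = (SOME k. stable (3 ^ k * n))"

definition st_complexity :: "nat \<Rightarrow> int" where
  "st_complexity n = int (complexity (3 ^ stab_exp n * n)) - 3 * int (stab_exp n)"

definition st_defect :: "nat \<Rightarrow> real" where
  "st_defect n = defect (3 ^ stab_exp n * n)"

definition st_int_defect :: "nat \<Rightarrow> int" where
  "st_int_defect n = int_defect (3 ^ stab_exp n * n)"

text \<open>The subscript \<open>a\<close> matters only modulo 3; the last case is \<open>k \<equiv> a + 2\<close>.\<close>

definition t :: "int \<Rightarrow> nat \<Rightarrow> real" where
  "t a k =
    (if [int k = a] (mod 3) then real k
     else if [int k = a + 1] (mod 3) then real k + defect 2
     else real k + 2 * defect 2)"

end

theory Submission imports Defs begin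

text \<open>The largest number written with \<open>k\<close> ones is
  \<open>E (3 * m) = 3 ^ m\<close>, \<open>E (3 * m + 2) = 2 * 3 ^ m\<close>, \<open>E (3 * m + 4) = 4 * 3 ^ m\<close> (and \<open>E 1 = 1\<close>).
  Writing \<open>c\<close> for the complexity of \<open>n\<close>, the condition \<open>D n \<le> k\<close> says \<open>E (c - k) \<le> n\<close> if \<open>k < c\<close>; taking
  logarithms turns this, class by class modulo 3, into \<open>\<delta> n \<le> t c k\<close>. Only \<open>c - k = 1\<close> does not
  follow the pattern, as there the logarithmic condition is \<open>4 / 3 \<le> n\<close>; this is where \<open>n > 1\<close>
  enters. Finally, equal defects force \<open>n ^ 3 = m ^ 3 * 3 ^ d\<close> with \<open>d\<close> the difference of the
  complexities, so that \<open>3\<close> divides \<open>d\<close> and \<open>t\<close> is the same function for \<open>n\<close> and \<open>m\<close>.\<close>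

subsection \<open>The largest number of given complexity\<close>

text \<open>The closed form of \<open>E\<close> as a recursion. Tripling starts only at 5, since
  \<open>max_val 4\<close> is 4 and not 3 times \<open>max_val 1\<close>. The value 1 at 0 is a
  default that keeps \<open>max_val_mult3\<close> and \<open>max_val_mult_le\<close> true
  there.\<close>

fun max_val :: "nat \<Rightarrow> nat" where
  "max_val 0 = 1"
| "max_val (Suc 0) = 1"
| "max_val (Suc (Suc 0)) = 2"
| "max_val (Suc (Suc (Suc 0))) = 3"
| "max_val (Suc (Suc (Suc (Suc 0)))) = 4"
| "max_val (Suc (Suc (Suc (Suc (Suc n))))) = 3 * max_val (Suc (Suc n))"

lemma max_val_add3:
  assumes "k \<ge> 2"
  shows "max_val (k + 3) = 3 * max_val k"
proof -
  obtain i where "k = Suc (Suc i)" using assms by (metis add_2_eq_Suc le_Suc_ex)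
  then show ?thesis by (simp add: numeral_3_eq_3)
qed

lemma max_val_mult3: "max_val (3 * m) = 3 ^ m"
proof (induction m)
  case (Suc m)
  show ?case
  proof (cases "m = 0")
    case True
    then show ?thesis by (simp add: numeral_3_eq_3)
  next
    case False
    then show ?thesis using Suc max_val_add3[of "3 * m"] by (simp add: add.commute)
  qed
qed simp

lemma max_val_mult3_add2: "max_val (3 * m + 2) = 2 * 3 ^ m"
proof (induction m)
  case 0
  show ?case by (simp add: numeral_2_eq_2)
next
  case (Suc m)
  then show ?case using max_val_add3[of "3 * m + 2"] by (simp add: algebra_simps)
qed

lemma max_val_mult3_add4: "max_val (3 * m + 4) = 4 * 3 ^ m"
proof (induction m)
  case 0
  show ?case using max_val.simps(5) by (simp add: numeral_eq_Suc)
next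
  case (Suc m)
  then show ?case using max_val_add3[of "3 * m + 4"] by (simp add: algebra_simps)
qed

lemma max_val_pos: "max_val k \<ge> 1"
  by (induction k rule: max_val.induct) auto

lemma max_val_Suc_less: "k \<ge> 1 \<Longrightarrow> max_val k < max_val (Suc k)"
  by (induction k rule: max_val.induct) auto

lemma max_val_less: "a \<ge> 1 \<Longrightarrow> a < b \<Longrightarrow> max_val a < max_val b"
proof (induction b)
  case (Suc b)
  then show ?case
    using max_val_Suc_less[of b] by (cases "a = b") (auto intro: less_trans)
qed simp

lemma max_val_mono: "a \<le> b \<Longrightarrow> max_val a \<le> max_val b"
  using max_val_less[of a b] max_val_pos[of b] by (cases "a = 0"; cases "a = b") auto

lemma max_val_le_iff: "a \<ge> 1 \<Longrightarrow> b \<ge> 1 \<Longrightarrow> max_val a \<le> max_val b \<longleftrightarrow> a \<le> b"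
  using max_val_less[of b a] max_val_mono[of a b] by force

lemma le_max_val: "k \<le> max_val k"
  by (induction k rule: max_val.induct) auto

text \<open>Three more ones in \<open>a\<close> triple both sides once \<open>a \<ge> 2\<close>, so
  only small \<open>a\<close> remain. The value 1 reduces to monotonicity; for 2, 3 and 4 the same
  reduction is applied to \<open>b\<close>.\<close>

lemma max_val_mult_le: "max_val a * max_val b \<le> max_val (a + b)"
proof (induction a rule: max_val.induct)
  case 2
  show ?case using max_val_mono[of b "Suc b"] by simp
next
  case 3
  show ?case by (induction b rule: max_val.induct) auto
next
  case 4
  show ?case by (induction b rule: max_val.induct) auto
next
  case 5
  show ?case by (induction b rule: max_val.induct) auto
qed auto

lemma num_ones_pos: "num_ones e \<ge> 1"
  by (induction e) auto

text \<open>Products are covered by \<open>max_val_mult_le\<close>. A sum of two numbers that are at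
  least 2 does not exceed their product, and a summand made of a single one is absorbed by the
  strict growth of \<open>max_val\<close>.\<close>

lemma expr_val_le_max_val: "expr_val e \<le> max_val (num_ones e)"
proof (induction e)
  case (Add e f)
  let ?a = "num_ones e" and ?b = "num_ones f"
  have pos: "?a \<ge> 1" "?b \<ge> 1" by (rule num_ones_pos)+
  have "max_val ?a + max_val ?b \<le> max_val (?a + ?b)"
  proof (cases "?a = 1 \<or> ?b = 1")
    case True
    then show ?thesis
      using pos max_val_Suc_less[of ?a] max_val_Suc_less[of ?b] by auto
  next
    case False
    with pos have "max_val ?a \<ge> 2" "max_val ?b \<ge> 2"
      using le_max_val[of ?a] le_max_val[of ?b] by linarith+
    then obtain x y where "max_val ?a = x + 2" "max_val ?b = y + 2"
      by (metis add.commute le_Suc_ex)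
    then have "max_val ?a + max_val ?b \<le> max_val ?a * max_val ?b"
      by (simp add: algebra_simps)
    then show ?thesis using max_val_mult_le[of ?a ?b] by linarith
  qed
  with Add show ?case by simp
next
  case (Mult e f)
  then have "expr_val e * expr_val f \<le> max_val (num_ones e) * max_val (num_ones f)"
    by (rule mult_le_mono)
  with max_val_mult_le[of "num_ones e" "num_ones f"] show ?case by simp
qed simp

lemma max_val_attained: "k \<ge> 1 \<Longrightarrow> \<exists>e. expr_val e = max_val k \<and> num_ones e = k"
proof (induction k rule: max_val.induct)
  case 2
  show ?case by (intro exI[of _ One]) simp
next
  case 3
  show ?case by (intro exI[of _ "Add One One"]) simp
next
  case 4
  show ?case by (intro exI[of _ "Add One (Add One One)"]) simp
next
  case 5
  show ?case by (intro exI[of _ "Add One (Add One (Add One One))"]) simp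
next
  case (6 k)
  then obtain e where "expr_val e = max_val (Suc (Suc k))" "num_ones e = Suc (Suc k)"
    by auto
  then show ?case by (intro exI[of _ "Mult (Add One (Add One One)) e"]) simp
qed simp

lemma complexity_le: "complexity (expr_val e) \<le> num_ones e"
  unfolding complexity_def by (rule Least_le) auto

lemma complexity_attained:
  assumes "n \<ge> 1"
  obtains e where "expr_val e = n" "num_ones e = complexity n"
proof -
  have "\<exists>e. expr_val e = n"
    using assms
  proof (induction n rule: nat_induct_at_least)
    case base
    show ?case by (intro exI[of _ One]) simp
  next
    case (Suc n)
    then obtain e where "expr_val e = n" by blast
    then show ?case by (intro exI[of _ "Add One e"]) simp
  qed
  then have "\<exists>k e. expr_val e = n \<and> num_ones e = k" by blast
  from LeastI_ex[OF this] show ?thesis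
    using that unfolding complexity_def by blast
qed

lemma complexity_pos: "n \<ge> 1 \<Longrightarrow> complexity n \<ge> 1"
  by (metis complexity_attained num_ones_pos)

lemma le_max_val_complexity: "n \<ge> 1 \<Longrightarrow> n \<le> max_val (complexity n)"
  by (metis complexity_attained expr_val_le_max_val)

lemma E_eq_max_val:
  assumes "k \<ge> 1"
  shows "E k = max_val k"
  unfolding E_def
proof (rule Greatest_equality)
  show "1 \<le> max_val k \<and> complexity (max_val k) \<le> k"
    using max_val_attained[OF assms] max_val_pos by (metis complexity_le)
next
  fix n assume "1 \<le> n \<and> complexity n \<le> k"
  then show "n \<le> max_val k"
    using le_max_val_complexity[of n] max_val_mono[of "complexity n" k] by linarith
qed

text \<open>A Galois connection between \<open>L\<close> and \<open>max_val\<close>. The greatest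
  element defining \<open>L n\<close> exists because 1 is a candidate and \<open>le_max_val\<close>
  bounds all candidates by \<open>n\<close>.\<close>

lemma le_L_iff:
  assumes "k \<ge> 1" "n \<ge> 1"
  shows "k \<le> L n \<longleftrightarrow> max_val k \<le> n"
proof -
  let ?P = "\<lambda>k. k \<ge> 1 \<and> E k \<le> n"
  have bound: "j \<le> n" if "?P j" for j
    using that E_eq_max_val[of j] le_max_val[of j] by auto
  have "?P 1" using E_eq_max_val[of 1] assms by simp
  then have L: "?P (L n)" unfolding L_def using bound by (rule GreatestI_nat)
  have "max_val k \<le> n" if "k \<le> L n"
    using L max_val_mono[OF that] E_eq_max_val[of "L n"] by auto
  moreover have "k \<le> L n" if "max_val k \<le> n"
    unfolding L_def using bound that E_eq_max_val[OF assms(1)] assms(1)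
    by (intro Greatest_le_nat) auto
  ultimately show ?thesis by blast
qed

lemma L_pos: "n \<ge> 1 \<Longrightarrow> L n \<ge> 1"
  using le_L_iff[of 1 n] by simp

lemma L_le_complexity:
  assumes "n \<ge> 1"
  shows "L n \<le> complexity n"
proof -
  have "max_val (L n) \<le> max_val (complexity n)"
    using le_L_iff[of "L n" n] L_pos[OF assms] le_max_val_complexity[OF assms] assms by simp
  then show ?thesis
    using max_val_le_iff L_pos complexity_pos assms by simp
qed

subsection \<open>The integer defect in terms of the defect\<close>

lemma complexity_2: "complexity 2 = 2"
proof (rule antisym)
  show "complexity 2 \<le> 2" using complexity_le[of "Add One One"] by (simp add: numeral_2_eq_2)
  have "complexity 2 \<noteq> 1" using le_max_val_complexity[of 2] by auto
  then show "2 \<le> complexity 2" using complexity_pos[of 2] by simp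
qed

lemma defect_2: "defect 2 = 2 - 3 * log 3 2"
  by (simp add: defect_def complexity_2)

lemma defect_2_nonneg: "defect 2 \<ge> 0"
proof -
  have "3 * log 3 2 = log 3 (2 ^ 3)" by (subst log_nat_power) auto
  also have "\<dots> \<le> log 3 (3 ^ 2)" by (subst log_le_cancel_iff) auto
  also have "\<dots> = 2" by (subst log_nat_power) auto
  finally show ?thesis by (simp add: defect_2)
qed

text \<open>The subscript is a complexity exceeding \<open>k\<close> by 0, 2 or 1 modulo 3. The
  corrections are put in the form \<open>s - 3 * log 3 s\<close> with \<open>s\<close> equal to 2 or
  4, to match \<open>defect_le_iff\<close>; for 4 this is twice \<open>defect 2\<close>.\<close>

lemma t_eqs:
  "t (int k + 3 * int m) k = real k"
  "t (int k + 2 + 3 * int m) k = real k + (2 - 3 * log 3 2)"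
  "t (int k + 1 + 3 * int m) k = real k + (4 - 3 * log 3 4)"
proof -
  have "log 3 4 = log 3 (2 ^ 2 :: real)" by simp
  also have "\<dots> = 2 * log 3 2" by (subst log_nat_power) auto
  finally have 4: "log 3 4 = 2 * log 3 (2 :: real)" .
  show "t (int k + 3 * int m) k = real k"
    by (simp add: t_def cong_def)
  have "\<not> [int k = int k + 2 + 3 * int m] (mod 3)"
    "[int k = int k + 2 + 3 * int m + 1] (mod 3)"
    "\<not> [int k = int k + 1 + 3 * int m] (mod 3)"
    "\<not> [int k = int k + 1 + 3 * int m + 1] (mod 3)"
    unfolding cong_def by presburger+
  then show "t (int k + 2 + 3 * int m) k = real k + (2 - 3 * log 3 2)"
    "t (int k + 1 + 3 * int m) k = real k + (4 - 3 * log 3 4)"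
    by (simp_all add: t_def defect_2 4)
qed

lemma t_cong: "[a = b] (mod 3) \<Longrightarrow> t a = t b"
proof
  fix k
  assume ab: "[a = b] (mod 3)"
  then have "[a + 1 = b + 1] (mod 3)" by (rule cong_add) simp
  with ab show "t a k = t b k" unfolding t_def cong_def by simp
qed

lemma le_t: "real k \<le> t a k"
  using defect_2_nonneg by (simp add: t_def)

text \<open>After cancelling \<open>k + s\<close>, both sides compare the logarithms of
  \<open>s * 3 ^ m\<close> and \<open>n\<close>.\<close>

lemma defect_le_iff:
  assumes "n \<ge> 1" "s \<ge> 1" "complexity n = k + s + 3 * m"
  shows "defect n \<le> real k + (real s - 3 * log 3 (real s)) \<longleftrightarrow> s * 3 ^ m \<le> n"
proof -
  have "log 3 (real (s * 3 ^ m)) = log 3 (real s) + real m"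
    using assms by (simp add: log_mult log_nat_power)
  then have "defect n \<le> real k + (real s - 3 * log 3 (real s)) \<longleftrightarrow>
      log 3 (real (s * 3 ^ m)) \<le> log 3 (real n)"
    using assms by (auto simp: defect_def)
  also have "\<dots> \<longleftrightarrow> real (s * 3 ^ m) \<le> real n"
    using assms by (subst log_le_cancel_iff) auto
  finally show ?thesis by (simp only: of_nat_le_iff)
qed

lemma int_defect_nonneg: "n \<ge> 1 \<Longrightarrow> int_defect n \<ge> 0"
  using L_le_complexity by (simp add: int_defect_def)

lemma int_defect_le_iff:
  assumes "n > 1"
  shows "int_defect n \<le> int k \<longleftrightarrow> defect n \<le> t (int (complexity n)) k"
proof -
  let ?c = "complexity n"
  have n: "n \<ge> 1" using assms by simp
  note L_pos[OF n]
  have D: "int_defect n \<le> int k \<longleftrightarrow> max_val j \<le> n" if "?c = k + j" "j \<ge> 1" for j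
    using le_L_iff[OF that(2) n] that by (auto simp: int_defect_def)
  have "?c \<le> k \<or> (\<exists>j \<ge> 1. ?c = k + j)" by presburger
  then consider "?c \<le> k" | j where "j \<ge> 1" "?c = k + j" by blast
  then show ?thesis
  proof cases
    case 1
    \<comment> \<open>Both sides of the equivalence are true in this case.\<close>
    have "log 3 (real n) \<ge> 0" using n by simp
    then have "defect n \<le> t (int ?c) k"
      using 1 le_t[of k "int ?c"] by (simp add: defect_def)
    then show ?thesis using 1 by (simp add: int_defect_def)
  next
    case j: 2
    \<comment> \<open>The pattern for the class of 1 modulo 3 begins at 4, which leaves 1
      over.\<close>
    have "j = 1 \<or> (\<exists>m. j = 3 * m \<or> j = 3 * m + 2 \<or> j = 3 * m + 4)"
      using j(1) by presburger
    then consider "j = 1" | m where "j = 3 * m" | m where "j = 3 * m + 2"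
      | m where "j = 3 * m + 4" by blast
    then show ?thesis
    proof cases
      case 1
      \<comment> \<open>As \<open>max_val 1 = 1\<close>, the left side is true. The right side
        amounts to \<open>4 \<le> 3 * n\<close>, true from 2 on.\<close>
      have "log 3 4 \<le> log 3 (3 * real n)"
        using assms by (subst log_le_cancel_iff) auto
      also have "\<dots> = 1 + log 3 (real n)" using n by (simp add: log_mult)
      finally have "defect n \<le> t (int ?c) k"
        using j 1 t_eqs(3)[of k 0] by (simp add: defect_def add.commute)
      then show ?thesis using D[OF j(2,1)] 1 n by simp
    next
      case (2 m)
      \<comment> \<open>One factor 3 is split off to serve as \<open>s\<close>, which must be
        positive; its correction \<open>3 - 3 * log 3 3\<close> is 0.\<close>
      then obtain i where "m = Suc i" using j(1) by (cases m) auto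
      then show ?thesis
        using D[OF j(2,1)] 2 j(2) t_eqs(1)[of k m] max_val_mult3[of m]
          defect_le_iff[OF n, of 3 k i] by (simp add: add_ac)
    next
      case (3 m)
      then show ?thesis
        using D[OF j(2,1)] j(2) t_eqs(2)[of k m] max_val_mult3_add2[of m]
          defect_le_iff[OF n, of 2 k m] by (simp add: add_ac)
    next
      case (4 m)
      \<comment> \<open>Since 4 is 1 + 3, \<open>t_eqs(3)\<close> is taken at
        \<open>Suc m\<close>.\<close>
      then show ?thesis
        using D[OF j(2,1)] j(2) t_eqs(3)[of k "Suc m"] max_val_mult3_add4[of m]
          defect_le_iff[OF n, of 4 k m] by (simp add: add_ac)
    qed
  qed
qed

text \<open>The free subscript \<open>a\<close> admits the stable complexity, which differs from a
  complexity by a multiple of 3.\<close>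

lemma int_defect_eq_least:
  assumes "n > 1" "[int (complexity n) = a] (mod 3)"
  shows "\<exists>k::nat. int_defect n = int k \<and> defect n \<le> t a k \<and> (\<forall>j. defect n \<le> t a j \<longrightarrow> k \<le> j)"
proof -
  obtain k where k: "int_defect n = int k"
    using int_defect_nonneg[of n] assms(1) by (metis less_imp_le nonneg_int_cases)
  show ?thesis
    using k int_defect_le_iff[OF assms(1)] t_cong[OF assms(2)]
    by (intro exI[of _ k]) auto
qed

subsection \<open>Equal defects\<close>

lemma complexity_3_pow_mult_le:
  assumes "n \<ge> 1"
  shows "complexity (3 ^ k * n) \<le> 3 * k + complexity n"
proof (induction k)
  case (Suc k)
  obtain e where e: "expr_val e = 3 ^ k * n" "num_ones e = complexity (3 ^ k * n)"
    using complexity_attained[of "3 ^ k * n"] assms by auto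
  have "3 ^ Suc k * n = expr_val (Mult (Add One (Add One One)) e)" using e by simp
  then have "complexity (3 ^ Suc k * n) \<le> 3 + complexity (3 ^ k * n)"
    using complexity_le[of "Mult (Add One (Add One One)) e"] e(2) by simp
  with Suc show ?case by simp
qed simp

text \<open>One better than \<open>complexity_3_pow_mult_le\<close> at \<open>n = 1\<close>. This
  saving is what excludes 1 both among equal defects and among stable numbers.\<close>

lemma complexity_3_pow_le:
  assumes "k \<ge> 1"
  shows "complexity (3 ^ k) \<le> 3 * k"
proof -
  obtain e where "expr_val e = 3 ^ k" "num_ones e = 3 * k"
    using max_val_attained[of "3 * k"] assms by (auto simp: max_val_mult3)
  then show ?thesis using complexity_le by metis
qed

text \<open>Comparing the exponents of the prime 3 shows that 3 divides \<open>d\<close>; then cube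
  roots can be taken.\<close>

lemma cube_eq_cube_mult_pow3:
  fixes n m d :: nat
  assumes "n ^ 3 = m ^ 3 * 3 ^ d" "m \<ge> 1"
  obtains j where "d = 3 * j" "n = 3 ^ j * m"
proof -
  have "n > 0" using assms by (intro Nat.gr0I) auto
  have "3 * multiplicity 3 n = multiplicity 3 (n ^ 3)"
    using \<open>n > 0\<close> by (simp add: prime_elem_multiplicity_power_distrib)
  also have "\<dots> = 3 * multiplicity 3 m + d"
    using assms by (simp add: prime_elem_multiplicity_mult_distrib
        prime_elem_multiplicity_power_distrib multiplicity_same_power)
  finally have "3 dvd d" by presburger
  then obtain j where d: "d = 3 * j" by auto
  then have "n ^ 3 = (3 ^ j * m) ^ 3"
    using assms(1) by (simp add: power_mult_distrib mult.commute flip: power_mult)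
  then have "n = 3 ^ j * m" by (simp add: power_eq_iff_eq_base)
  with d that show ?thesis by blast
qed

lemma defect_eq_imp_cube_eq:
  assumes "n \<ge> 1" "m \<ge> 1" "defect n = defect m" "complexity n = complexity m + d"
  shows "n ^ 3 = m ^ 3 * 3 ^ d"
proof -
  have "log 3 (real (n ^ 3)) = 3 * log 3 (real n)"
    using assms(1) by (simp add: log_nat_power)
  also have "\<dots> = 3 * log 3 (real m) + real d"
    using assms(3,4) by (simp add: defect_def)
  also have "\<dots> = log 3 (real (m ^ 3 * 3 ^ d))"
    using assms(2) by (simp add: log_mult log_nat_power)
  finally have "real (n ^ 3) = real (m ^ 3 * 3 ^ d)"
    using assms log_inj[of 3] by (auto dest: inj_onD)
  then show ?thesis by (simp only: of_nat_eq_iff)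
qed

text \<open>Either the numbers coincide, or both exceed 1 and their complexities agree modulo 3, so
  that both integer defects are the least solution of the same inequality.\<close>

lemma int_defect_eq_if_defect_eq:
  assumes "n \<ge> 1" "m \<ge> 1" "defect n = defect m"
  shows "int_defect n = int_defect m"
  using assms
proof (induction "complexity m" "complexity n" arbitrary: m n rule: linorder_wlog)
  case le
  then obtain d where d: "complexity n = complexity m + d" by (metis le_Suc_ex)
  obtain j where j: "d = 3 * j" "n = 3 ^ j * m"
    using cube_eq_cube_mult_pow3 defect_eq_imp_cube_eq le.prems d by metis
  show ?case
  proof (cases "j = 0")
    case False
    \<comment> \<open>Otherwise \<open>3 ^ j\<close> would need more than \<open>3 * j\<close>
      ones.\<close>
    have "m \<noteq> 1"
    proof
      assume "m = 1"
      then show False using j d False complexity_3_pow_le[of j] complexity_pos[of 1] by simp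
    qed
    then have gt: "m > 1" "n > 1"
      using le.prems j False by (auto intro: less_le_trans[of _ m])
    have "[int (complexity n) = int (complexity m)] (mod 3)"
      by (simp add: d j(1) cong_def)
    then show ?thesis
      using int_defect_eq_least[OF gt(2)] int_defect_eq_least[OF gt(1)] le.prems
      by (metis cong_refl nle_le)
  qed (use j in simp)
next
  case sym
  then show ?case by metis
qed

subsection \<open>Stability\<close>

text \<open>Any \<open>k\<close> minimizing \<open>complexity (3 ^ k * n) - 3 * k\<close> works,
  because further factors 3 can never raise this difference.\<close>

lemma ex_stable:
  assumes "n \<ge> 1"
  shows "\<exists>k. stable (3 ^ k * n)"
proof -
  define f where "f k = complexity (3 ^ k * n)" for k
  \<comment> \<open>This bound makes the truncated subtraction in the minimization exact.\<close>
  have lower: "3 * k \<le> f k" for k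
  proof (cases "k = 0")
    case False
    have "3 ^ k * n \<le> max_val (f k)"
      unfolding f_def using assms by (intro le_max_val_complexity) simp
    moreover have "3 ^ k * 1 \<le> 3 ^ k * n" using assms by (intro mult_le_mono) auto
    ultimately have "max_val (3 * k) \<le> max_val (f k)" unfolding max_val_mult3 by linarith
    then show ?thesis
      using False assms max_val_le_iff[of "3 * k" "f k"]
        complexity_pos[of "3 ^ k * n"] by (simp add: f_def)
  qed simp
  obtain k where k: "\<And>i. f k - 3 * k \<le> f i - 3 * i"
    using ex_has_least_nat[of "\<lambda>_. True" 0 "\<lambda>i. f i - 3 * i"] by auto
  have "complexity (3 ^ i * (3 ^ k * n)) = 3 * i + complexity (3 ^ k * n)" for i
  proof (rule antisym)
    show "complexity (3 ^ i * (3 ^ k * n)) \<le> 3 * i + complexity (3 ^ k * n)"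
      using assms by (intro complexity_3_pow_mult_le) simp
    obtain a b where "f k = 3 * k + a" "f (i + k) = 3 * (i + k) + b"
      using lower le_Suc_ex by metis
    with k[of "i + k"] have "3 * i + f k \<le> f (i + k)" by simp
    then show "3 * i + complexity (3 ^ k * n) \<le> complexity (3 ^ i * (3 ^ k * n))"
      by (simp add: f_def power_add mult.assoc)
  qed
  then show ?thesis unfolding stable_def by blast
qed

lemma not_stable_1: "\<not> stable 1"
proof
  assume "stable 1"
  then have "complexity (3 ^ 1 * 1) = 3 * 1 + complexity 1" unfolding stable_def by blast
  then show False using complexity_3_pow_le[of 1] complexity_pos[of 1] by simp
qed

text \<open>Lets \<open>int_defect_eq_least\<close> apply to the stable notions for every positive
  \<open>n\<close>, including 1.\<close>

lemma stab_exp_gt_1: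
  assumes "n \<ge> 1"
  shows "3 ^ stab_exp n * n > 1"
proof -
  have "stable (3 ^ stab_exp n * n)"
    unfolding stab_exp_def using ex_stable[OF assms] by (rule someI_ex)
  then have "3 ^ stab_exp n * n \<noteq> 1" using not_stable_1 by metis
  moreover have "3 ^ stab_exp n * n > 0" using assms by simp
  ultimately show ?thesis by linarith
qed

theorem theorem3p12:
  shows "(\<forall>n::nat. n > 1 \<longrightarrow>
            (\<exists>k::nat. int_defect n = int k \<and>
                defect n \<le> t (int (complexity n)) k \<and>
                (\<forall>j::nat. defect n \<le> t (int (complexity n)) j \<longrightarrow> k \<le> j)))
       \<and> (\<forall>n::nat. n \<ge> 1 \<longrightarrow>
            (\<exists>k::nat. st_int_defect n = int k \<and>
                st_defect n \<le> t (st_complexity n) k \<and>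
                (\<forall>j::nat. st_defect n \<le> t (st_complexity n) j \<longrightarrow> k \<le> j)))
       \<and> (\<forall>n m::nat. n \<ge> 1 \<longrightarrow> m \<ge> 1 \<longrightarrow>
            (defect n = defect m \<longrightarrow> int_defect n = int_defect m) \<and>
            (st_defect n = st_defect m \<longrightarrow> st_int_defect n = st_int_defect m))"
proof (intro conjI allI impI)
  fix n :: nat assume "n > 1"
  then show "\<exists>k::nat. int_defect n = int k \<and> defect n \<le> t (int (complexity n)) k \<and>
      (\<forall>j::nat. defect n \<le> t (int (complexity n)) j \<longrightarrow> k \<le> j)"
    by (rule int_defect_eq_least) simp
next
  fix n :: nat assume "n \<ge> 1"
  moreover have "[int (complexity (3 ^ stab_exp n * n)) = st_complexity n] (mod 3)"
    by (simp add: st_complexity_def cong_iff_dvd_diff)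
  ultimately show "\<exists>k::nat. st_int_defect n = int k \<and> st_defect n \<le> t (st_complexity n) k \<and>
      (\<forall>j::nat. st_defect n \<le> t (st_complexity n) j \<longrightarrow> k \<le> j)"
    unfolding st_int_defect_def st_defect_def
    by (intro int_defect_eq_least stab_exp_gt_1)
next
  fix n m :: nat assume "n \<ge> 1" "m \<ge> 1" "defect n = defect m"
  then show "int_defect n = int_defect m" by (rule int_defect_eq_if_defect_eq)
next
  fix n m :: nat assume "n \<ge> 1" "m \<ge> 1" "st_defect n = st_defect m"
  then show "st_int_defect n = st_int_defect m"
    unfolding st_int_defect_def st_defect_def
    by (intro int_defect_eq_if_defect_eq) auto
qed

end
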